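(* Fix $n \in \mathbb{N}$, $n\ge 1$. 1. The number of subsets $S$ of $\{1,2,\ldots,n\}$ with $n \in S$ whose difference set $D(S)$ contains only even numbers is $2^{\lfloor (n-1)/2 \rfloor}$. 2. The number of subsets $S$ of $\{1,2,\ldots,n\}$ whose difference set $D(S)$ contains only even numbers (the empty set and sets with exactly one element vacuously satisfy this requirement) is $$\begin{cases} 3\cdot 2^{(n-1)/2} - 1, & \text{if } n \text{ is odd};\\ 2\cdot 2^{n/2} - 1, & \text{if } n \text{ is even}.\end{cases}$$
   Context: For a finite set $S = \{s_1 < s_2 < \cdots < s_k\}$ of natural numbers with $k \ge 2$, the difference set is $D(S) = \{s_2-s_1, s_3-s_2, \ldots, s_k-s_{k-1}\}$; for the empty set and one-element sets, $D(S) = \emptyset$, so any condition of the form "$D(S)$ contains only even numbers" holds vacuously for them. *)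

theory Defs
  imports Main
begin

(* sorted_list_of_set S ! i is s_(i+1) in the enumeration S = {s_1 < ... < s_k}.
   The list is strictly increasing, so the subtraction on nat never truncates.
   Meaningful for finite S only: sorted_list_of_set of an infinite set is []. *)
definition difference_set :: "nat set \<Rightarrow> nat set" where
  "difference_set S =
     {sorted_list_of_set S ! Suc i - sorted_list_of_set S ! i | i. Suc i < card S}"

end

theory Submission
  imports Defs
begin

text \<open>
  All consecutive differences of a finite set are even exactly when all its elements have the
  same parity, since parity is then carried along the increasing enumeration
  (\<open>even_differences_iff_constant_parity\<close>). The counting problem is thus about subsets of a
  single parity class. Containing \<open>n\<close> fixes the class to be that of \<open>n\<close> and leaves a free choice
  among the \<open>(n - 1) div 2\<close> smaller members of it. Without that condition the sets are the
  subsets of the \<open>n div 2\<close> even numbers together with the subsets of the \<open>Suc n div 2\<close> odd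
  numbers; the two families share only the empty set, which gives
  \<open>2 ^ (n div 2) + 2 ^ (Suc n div 2) - 1\<close>.
\<close>

lemma even_differences_iff_constant_parity:
  fixes S :: "nat set"
  assumes "finite S"
  shows "(\<forall>d\<in>difference_set S. even d) \<longleftrightarrow> (\<forall>x\<in>S. \<forall>y\<in>S. even x \<longleftrightarrow> even y)"
proof -
  define xs where "xs = sorted_list_of_set S"
  have set_xs: "set xs = S" and len: "length xs = card S" and "sorted xs"
    using assms by (auto simp: xs_def)
  \<comment> \<open>As \<open>xs\<close> is increasing, the subtraction is never truncated and so respects parity.\<close>
  have step: "even (xs ! Suc i - xs ! i) \<longleftrightarrow> (even (xs ! Suc i) \<longleftrightarrow> even (xs ! i))"
    if "Suc i < card S" for i
    using sorted_nth_mono[OF \<open>sorted xs\<close>, of i "Suc i"] that len by (simp add: even_diff_nat)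
  have D: "(\<forall>d\<in>difference_set S. even d) \<longleftrightarrow>
      (\<forall>i. Suc i < card S \<longrightarrow> (even (xs ! Suc i) \<longleftrightarrow> even (xs ! i)))"
    unfolding difference_set_def xs_def[symmetric] using step by blast
  show ?thesis
  proof
    assume even: "\<forall>d\<in>difference_set S. even d"
    have first: "even (xs ! i) \<longleftrightarrow> even (xs ! 0)" if "i < card S" for i
      using that
    proof (induction i)
      case (Suc i)
      then show ?case using even D by simp
    qed simp
    show "\<forall>x\<in>S. \<forall>y\<in>S. even x \<longleftrightarrow> even y"
      using first by (metis in_set_conv_nth len set_xs)
  next
    assume same: "\<forall>x\<in>S. \<forall>y\<in>S. even x \<longleftrightarrow> even y"
    have "xs ! i \<in> S" if "i < card S" for i
      using that len set_xs nth_mem by metis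
    then show "\<forall>d\<in>difference_set S. even d"
      unfolding D using same Suc_lessD by blast
  qed
qed

lemma card_evens_upto: "card {k \<in> {1..n::nat}. even k} = n div 2"
proof (induction n)
  case (Suc n)
  have "{k \<in> {1..Suc n}. even k} =
      (if even (Suc n) then insert (Suc n) {k \<in> {1..n}. even k} else {k \<in> {1..n}. even k})"
    by (auto simp: le_Suc_eq)
  then show ?case using Suc by simp
qed simp

lemma card_odds_upto: "card {k \<in> {1..n::nat}. odd k} = Suc n div 2"
proof (induction n)
  case (Suc n)
  have "{k \<in> {1..Suc n}. odd k} =
      (if odd (Suc n) then insert (Suc n) {k \<in> {1..n}. odd k} else {k \<in> {1..n}. odd k})"
    by (auto simp: le_Suc_eq)
  then show ?case using Suc by simp
qed simp

lemma card_same_parity_below: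
  assumes "n \<ge> 1"
  shows "card {k \<in> {1..n - 1}. even k \<longleftrightarrow> even n} = (n - 1) div 2"
proof (cases "even n")
  case True
  then show ?thesis using card_evens_upto[of "n - 1"] by simp
next
  case False
  then have "Suc (n - 1) div 2 = (n - 1) div 2" using assms by presburger
  with False show ?thesis using card_odds_upto[of "n - 1"] by simp
qed

lemma constant_parity_subsets_with_max:
  fixes n :: nat
  assumes "n \<ge> 1"
  shows "{S. S \<subseteq> {1..n} \<and> n \<in> S \<and> (\<forall>x\<in>S. \<forall>y\<in>S. even x \<longleftrightarrow> even y)} =
    insert n ` Pow {k \<in> {1..n - 1}. even k \<longleftrightarrow> even n}" (is "?L = ?R")
proof
  show "?L \<subseteq> ?R"
  proof
    fix S assume S: "S \<in> ?L"
    have "S - {n} \<in> Pow {k \<in> {1..n - 1}. even k \<longleftrightarrow> even n}"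
      using S by fastforce
    moreover have "S = insert n (S - {n})" using S by auto
    ultimately show "S \<in> ?R" by blast
  qed
  show "?R \<subseteq> ?L"
  proof
    fix S assume "S \<in> ?R"
    then obtain T where S: "S = insert n T" and T: "T \<subseteq> {k \<in> {1..n - 1}. even k \<longleftrightarrow> even n}"
      by blast
    have "T \<subseteq> {1..n}" using T by fastforce
    then have "S \<subseteq> {1..n}" using S assms by simp
    moreover have "even k \<longleftrightarrow> even n" if "k \<in> S" for k using that S T by blast
    ultimately show "S \<in> ?L" using S by blast
  qed
qed

lemma constant_parity_subsets:
  "{S. S \<subseteq> A \<and> (\<forall>x\<in>S. \<forall>y\<in>S. even x \<longleftrightarrow> even y)} =
    Pow {k \<in> A. even k} \<union> Pow {k \<in> A. odd k}"
  by blast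

theorem theorem1p8:
  fixes n :: nat
  assumes "n \<ge> 1"
  shows "card {S. S \<subseteq> {1..n} \<and> n \<in> S \<and> (\<forall>d\<in>difference_set S. even d)}
           = 2 ^ ((n - 1) div 2) \<and>
         card {S. S \<subseteq> {1..n} \<and> (\<forall>d\<in>difference_set S. even d)}
           = (if odd n then 3 * 2 ^ ((n - 1) div 2) - 1 else 2 * 2 ^ (n div 2) - 1)"
proof -
  have parity: "(\<forall>d\<in>difference_set S. even d) \<longleftrightarrow> (\<forall>x\<in>S. \<forall>y\<in>S. even x \<longleftrightarrow> even y)"
    if "S \<subseteq> {1..n}" for S
    using even_differences_iff_constant_parity[OF finite_subset[OF that]] by simp
  let ?B = "{k \<in> {1..n - 1}. even k \<longleftrightarrow> even n}"
  have "{S. S \<subseteq> {1..n} \<and> n \<in> S \<and> (\<forall>d\<in>difference_set S. even d)} = insert n ` Pow ?B"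
    unfolding constant_parity_subsets_with_max[OF assms, symmetric]
    by (intro Collect_cong conj_cong refl parity)
  moreover have "inj_on (insert n) (Pow ?B)"
  proof (rule inj_onI)
    fix X Y assume "X \<in> Pow ?B" "Y \<in> Pow ?B" and eq: "insert n X = insert n Y"
    moreover have "n \<notin> ?B" using assms by auto
    ultimately have "n \<notin> X" "n \<notin> Y" by (meson PowD subsetD)+
    then show "X = Y" using eq by (simp add: insert_ident)
  qed
  ultimately have with_max: "card {S. S \<subseteq> {1..n} \<and> n \<in> S \<and> (\<forall>d\<in>difference_set S. even d)}
      = 2 ^ ((n - 1) div 2)"
    using card_same_parity_below[OF assms] card_Pow[of ?B] by (simp add: card_image)

  let ?E = "{k \<in> {1..n}. even k}" and ?O = "{k \<in> {1..n}. odd k}"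
  have "{S. S \<subseteq> {1..n} \<and> (\<forall>d\<in>difference_set S. even d)} =
      {S. S \<subseteq> {1..n} \<and> (\<forall>x\<in>S. \<forall>y\<in>S. even x \<longleftrightarrow> even y)}"
    by (intro Collect_cong conj_cong refl parity)
  also have "\<dots> = Pow ?E \<union> Pow ?O" by (rule constant_parity_subsets)
  finally have family: "{S. S \<subseteq> {1..n} \<and> (\<forall>d\<in>difference_set S. even d)} = Pow ?E \<union> Pow ?O" .
  have "Pow ?E \<inter> Pow ?O = {{}}" by blast
  then have "card (Pow ?E \<union> Pow ?O) + 1 = card (Pow ?E) + card (Pow ?O)"
    using card_Un_Int[of "Pow ?E" "Pow ?O"] by simp
  also have "\<dots> = 2 ^ (n div 2) + 2 ^ (Suc n div 2)"
    using card_Pow[of ?E] card_Pow[of ?O] card_evens_upto[of n] card_odds_upto[of n] by simp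
  finally have "card (Pow ?E \<union> Pow ?O) = 2 ^ (n div 2) + 2 ^ (Suc n div 2) - 1" by simp
  then have "card {S. S \<subseteq> {1..n} \<and> (\<forall>d\<in>difference_set S. even d)}
      = (if odd n then 3 * 2 ^ ((n - 1) div 2) - 1 else 2 * 2 ^ (n div 2) - 1)"
    unfolding family by (cases "even n") (auto elim: oddE)
  with with_max show ?thesis by (rule conjI)
qed

end
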